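(* $N(48) \ge 10$; that is, there exist $10$ mutually orthogonal Latin squares of order $48$.
   Context: A Latin square of order $n$ on an $n$-element set $V$ is an $n\times n$ matrix every row and every column of which is a permutation of $V$. Two Latin squares $L_1=(v_{ij})$ and $L_2=(w_{ij})$ of order $n$ (on symbol sets $V$, $W$ of size $n$) are orthogonal if the $n^2$ pairs $(v_{ij},w_{ij})$ are all distinct, i.e. they exhaust $V\times W$. A set of Latin squares is a set of mutually orthogonal Latin squares (MOLS) if any two of them are orthogonal. $N(n)$ denotes the largest size of a set of MOLS of order $n$. *)

theory Defs
  imports "Jordan_Normal_Form.Matrix"
begin

definition latin_square :: "nat \<Rightarrow> 'a set \<Rightarrow> 'a mat \<Rightarrow> bool" where
  "latin_square n V L \<longleftrightarrow>
     finite V \<and> card V = n \<and> L \<in> carrier_mat n n \<and>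
     (\<forall>i<n. bij_betw (\<lambda>j. L $$ (i, j)) {..<n} V) \<and>
     (\<forall>j<n. bij_betw (\<lambda>i. L $$ (i, j)) {..<n} V)"

definition orthogonal_squares :: "nat \<Rightarrow> 'a mat \<Rightarrow> 'b mat \<Rightarrow> bool" where
  "orthogonal_squares n L M \<longleftrightarrow>
     inj_on (\<lambda>(i, j). (L $$ (i, j), M $$ (i, j))) ({..<n} \<times> {..<n})"

text \<open>The symbol set may differ from square to square.\<close>

definition mols :: "nat \<Rightarrow> 'a mat set \<Rightarrow> bool" where
  "mols n S \<longleftrightarrow>
     (\<forall>L\<in>S. \<exists>V. latin_square n V L) \<and> pairwise (orthogonal_squares n) S"

text \<open>Since \<^typ>\<open>nat\<close> is infinite, it provides enough symbols for every order. The maximum exists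
  for \<open>n \<ge> 2\<close>, see \<open>finite_mols_sizes\<close> below; for \<open>n = 1\<close> there are arbitrarily large sets of
  MOLS and the value is unspecified.\<close>

definition max_mols :: "nat \<Rightarrow> nat" where
  "max_mols n = Max {card S |S :: nat mat set. finite S \<and> mols n S}"

lemma mols_bound:
  assumes n: "n \<ge> 2" and S: "mols n S"
  shows "finite S \<and> card S < n"
proof -
  have ex: "\<exists>c. c \<in> {1..<n} \<and> L $$ (1, c) = L $$ (0, 0)" if L: "L \<in> S" for L
  proof -
    obtain V where V: "latin_square n V L" using S L by (auto simp: mols_def)
    have r0: "bij_betw (\<lambda>j. L $$ (0, j)) {..<n} V" and r1: "bij_betw (\<lambda>j. L $$ (1, j)) {..<n} V"
      and c0: "bij_betw (\<lambda>i. L $$ (i, 0)) {..<n} V"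
      using V n by (auto simp: latin_square_def)
    have "L $$ (0, 0) \<in> V" using bij_betwE[OF r0] n by auto
    then obtain c where c: "c < n" "L $$ (1, c) = L $$ (0, 0)"
      using bij_betw_imp_surj_on[OF r1] by force
    moreover have "c \<noteq> 0"
    proof
      assume "c = 0"
      with c have "L $$ (1, 0) = L $$ (0, 0)" by simp
      from inj_onD[OF bij_betw_imp_inj_on[OF c0] this] n show False by simp
    qed
    ultimately show ?thesis by (intro exI[of _ c]) auto
  qed
  then obtain c where c: "\<And>L. L \<in> S \<Longrightarrow> c L \<in> {1..<n} \<and> L $$ (1, c L) = L $$ (0, 0)" by metis
  have inj: "inj_on c S"
  proof (rule inj_onI, rule ccontr)
    fix L M assume LM: "L \<in> S" "M \<in> S" "c L = c M" "L \<noteq> M"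
    then have o: "orthogonal_squares n L M" using S by (auto simp: mols_def pairwise_def)
    have "(1, c L) = (0::nat, 0::nat)"
      by (rule inj_onD[OF o[unfolded orthogonal_squares_def]])
        (use c[OF LM(1)] c[OF LM(2)] LM n in auto)
    then show False by simp
  qed
  have sub: "c ` S \<subseteq> {1..<n}" using c by blast
  have "finite S" using inj sub by (meson finite_atLeastLessThan finite_subset finite_imageD)
  moreover have "card S \<le> card {1..<n}" using card_inj_on_le[OF inj sub] by simp
  ultimately show ?thesis using n by auto
qed

lemma finite_mols_sizes:
  assumes "n \<ge> 2"
  shows "finite {card S |S :: 'a mat set. finite S \<and> mols n S}"
  by (rule finite_subset[of _ "{..<n}"]) (use mols_bound[OF assms] in auto)

lemma le_max_mols_iff:
  assumes n: "n \<ge> 2"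
  shows "k \<le> max_mols n \<longleftrightarrow> (\<exists>S :: nat mat set. finite S \<and> mols n S \<and> card S = k)"
proof
  let ?A = "{card S |S :: nat mat set. finite S \<and> mols n S}"
  have "mols n ({} :: nat mat set)" by (simp add: mols_def)
  then have ne: "?A \<noteq> {}" by blast
  assume k: "k \<le> max_mols n"
  have "max_mols n \<in> ?A" unfolding max_mols_def using finite_mols_sizes[OF n] ne by (rule Max_in)
  then obtain S :: "nat mat set" where S: "finite S" "mols n S" "card S = max_mols n" by auto
  then obtain T where T: "T \<subseteq> S" "card T = k" using k by (metis obtain_subset_with_card_n)
  then have "mols n T" using S(2) by (auto simp: mols_def intro: pairwise_subset)
  with T S(1) show "\<exists>S :: nat mat set. finite S \<and> mols n S \<and> card S = k"
    by (metis finite_subset)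
next
  assume "\<exists>S :: nat mat set. finite S \<and> mols n S \<and> card S = k"
  then show "k \<le> max_mols n"
    unfolding max_mols_def using finite_mols_sizes[OF n] by (intro Max_ge) auto
qed

end

theory Submission
  imports Defs "HOL-Algebra.Coset" "HOL-Library.Code_Binary_Nat"
begin

text \<open>
  Ten MOLS of order 48 come from a difference matrix with 11 rows and 48 columns over the group
  \<open>\<int>\<^sub>2\<^sup>4 \<times> \<int>\<^sub>3\<close>: the quotients of any two rows run through the whole group, so translating the rows of
  the matrix, normalised to have first row \<open>\<one>\<close>, gives the squares.

  The matrix was found by computer under the following ansatz. The columns are the pairs \<open>(z, u)\<close>
  with \<open>z < 12\<close> and \<open>u \<in> \<int>\<^sub>2\<^sup>2\<close>, and row \<open>k\<close> has the entry \<open>(a\<^sub>k(z) + s\<^sub>k(u), b\<^sub>k(z))\<close> there. The \<open>b\<^sub>k\<close> are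
  11 rows of a generalised Hadamard matrix of order 12 over \<open>\<int>\<^sub>3\<close>, and the \<open>s\<^sub>k\<close> are linear maps
  \<open>\<int>\<^sub>2\<^sup>2 \<rightarrow> \<int>\<^sub>2\<^sup>4\<close> whose pairwise differences are injective. The \<open>a\<^sub>k(z)\<close> were then determined by
  requiring invariance under a group of order 6 that permutes the rows and the \<open>z\<close>.
\<close>

lemma orthogonal_squares_commute:
  "orthogonal_squares n L M \<longleftrightarrow> orthogonal_squares n M L"
  unfolding orthogonal_squares_def inj_on_def by auto

lemma (in group) inv_mult_cancel_left:
  assumes "g \<in> carrier G" "x \<in> carrier G" "y \<in> carrier G"
  shows "inv (g \<otimes> x) \<otimes> (g \<otimes> y) = inv x \<otimes> y"
proof -
  have "inv g \<otimes> (g \<otimes> y) = y"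
    using assms by (simp flip: m_assoc)
  then show ?thesis
    using assms by (simp add: inv_mult_group m_assoc)
qed

text \<open>At cell \<open>(i, j)\<close> the squares \<open>k\<close> and \<open>l\<close> hold
  \<open>e i\<close> times a factor depending on \<open>j\<close>. In the left quotient of the two
  entries \<open>e i\<close> cancels, so a pair of entries determines \<open>j\<close> by
  \<open>diff\<close>, and then \<open>i\<close> by cancellation.\<close>

lemma (in group) le_max_mols_if_difference_matrix:
  assumes n: "order G = n" "n \<ge> 2"
    and D: "\<And>k j. k \<le> m \<Longrightarrow> j < n \<Longrightarrow> D k j \<in> carrier G"
    and diff: "\<And>k l. k < l \<Longrightarrow> l \<le> m \<Longrightarrow> inj_on (\<lambda>j. inv (D k j) \<otimes> D l j) {..<n}"
  shows "m \<le> max_mols n"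
proof -
  have fin: "finite (carrier G)" and card: "card (carrier G) = n"
    using n by (auto simp: order_def intro: card_ge_0_finite)
  \<comment> \<open>\<open>max_mols\<close> ranges over matrices of naturals, so group elements are
    coded as numbers.\<close>
  obtain c :: "'a \<Rightarrow> nat" where c: "bij_betw c (carrier G) {..<n}"
    using ex_bij_betw_finite_nat[OF fin] card by (auto simp: atLeast0LessThan)
  define e where "e = inv_into (carrier G) c"
  have e: "bij_betw e {..<n} (carrier G)"
    unfolding e_def using c by (rule bij_betw_inv_into)
  define E where "E k j = inv (D 0 j) \<otimes> D k j" for k j
  define Q where "Q k = mat n n (\<lambda>(i, j). c (e i \<otimes> E k j))" for k
  have e_carrier: "e i \<in> carrier G" if "i < n" for i
    using bij_betwE[OF e] that by blast
  have E_carrier: "E k j \<in> carrier G" if "k \<le> m" "j < n" for k j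
    using D that by (auto simp: E_def)
  have c_inj: "x = y" if "c x = c y" "x \<in> carrier G" "y \<in> carrier G" for x y
    using bij_betw_imp_inj_on[OF c] that by (auto dest: inj_onD)
  have Q_index: "Q k $$ (i, j) = c (e i \<otimes> E k j)" if "i < n" "j < n" for k i j
    using that by (simp add: Q_def)
  have E_diff: "inv (E k j) \<otimes> E l j = inv (D k j) \<otimes> D l j" if "k \<le> m" "l \<le> m" "j < n" for k l j
    using D that by (simp add: E_def inv_mult_cancel_left)
  have bij: "bij_betw f {..<n} {..<n}" if "f ` {..<n} \<subseteq> {..<n}" "inj_on f {..<n}"
    for f :: "nat \<Rightarrow> nat"
    using that by (simp add: bij_betw_def endo_inj_surj)
  have latin: "latin_square n {..<n} (Q k)" if k: "k \<in> {1..m}" for k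
  proof -
    have range: "Q k $$ (i, j) < n" if "i < n" "j < n" for i j
      using bij_betwE[OF c] e_carrier E_carrier k that by (auto simp: Q_index)
    have "inj_on (\<lambda>j. Q k $$ (i, j)) {..<n}" if i: "i < n" for i
    proof (rule inj_onI)
      fix j j' assume j: "j \<in> {..<n}" "j' \<in> {..<n}" "Q k $$ (i, j) = Q k $$ (i, j')"
      then have "e i \<otimes> E k j = e i \<otimes> E k j'"
        using i k e_carrier E_carrier by (intro c_inj) (auto simp: Q_index)
      then have "E k j = E k j'"
        using i j k e_carrier E_carrier by auto
      \<comment> \<open>\<open>E k\<close> is the quotient of rows 0 and \<open>k\<close>. Row 0 is
        spent on this, so \<open>m + 1\<close> rows yield \<open>m\<close> squares.\<close>
      then show "j = j'"
        using inj_onD[OF diff[of 0 k]] j k by (auto simp: E_def)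
    qed
    moreover have "inj_on (\<lambda>i. Q k $$ (i, j)) {..<n}" if j: "j < n" for j
    proof (rule inj_onI)
      fix i i' assume i: "i \<in> {..<n}" "i' \<in> {..<n}" "Q k $$ (i, j) = Q k $$ (i', j)"
      then have "e i \<otimes> E k j = e i' \<otimes> E k j"
        using j k e_carrier E_carrier by (intro c_inj) (auto simp: Q_index)
      then have "e i = e i'"
        using i j k e_carrier E_carrier by auto
      then show "i = i'"
        using bij_betw_imp_inj_on[OF e] i by (auto dest: inj_onD)
    qed
    ultimately show ?thesis
      unfolding latin_square_def using range by (auto intro!: bij simp: Q_def)
  qed
  have orth: "orthogonal_squares n (Q k) (Q l)" if kl: "k < l" "l \<le> m" for k l
    unfolding orthogonal_squares_def
  proof (rule inj_onI, clarsimp)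
    fix i j i' j' assume ij: "i < n" "j < n" "i' < n" "j' < n"
      and "Q k $$ (i, j) = Q k $$ (i', j')" "Q l $$ (i, j) = Q l $$ (i', j')"
    then have eq: "e i \<otimes> E k j = e i' \<otimes> E k j'" "e i \<otimes> E l j = e i' \<otimes> E l j'"
      using kl e_carrier E_carrier by (auto simp: Q_index intro: c_inj)
    have "inv (E k j) \<otimes> E l j = inv (E k j') \<otimes> E l j'"
      using inv_mult_cancel_left[of "e i" "E k j" "E l j"] inv_mult_cancel_left[of "e i'" "E k j'" "E l j'"]
        eq e_carrier E_carrier ij kl by simp
    then have "inv (D k j) \<otimes> D l j = inv (D k j') \<otimes> D l j'"
      using E_diff kl ij by simp
    then have j: "j = j'"
      using inj_onD[OF diff[OF kl]] ij by auto
    then have "e i = e i'"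
      using eq(1) ij kl e_carrier E_carrier by auto
    then show "i = i' \<and> j = j'"
      using j bij_betw_imp_inj_on[OF e] ij by (auto dest: inj_onD)
  qed
  \<comment> \<open>Equal squares would make the quotient of rows \<open>k\<close> and
    \<open>l\<close> constantly \<open>\<one>\<close>, which is not injective on the two columns 0
    and 1.\<close>
  have Q_neq: "Q k \<noteq> Q l" if kl: "k < l" "l \<le> m" for k l
  proof
    assume "Q k = Q l"
    then have "e 0 \<otimes> E k j = e 0 \<otimes> E l j" if "j < n" for j
      using that kl n(2) e_carrier E_carrier Q_index[of 0 j k] Q_index[of 0 j l] by (intro c_inj) auto
    then have "E k j = E l j" if "j < n" for j
      using that kl n e_carrier E_carrier by auto
    then have "inv (D k j) \<otimes> D l j = \<one>" if "j < n" for j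
      using that kl E_carrier E_diff[of k l j] by simp
    then have "inv (D k 0) \<otimes> D l 0 = inv (D k 1) \<otimes> D l 1"
      using n by simp
    then show False
      using inj_onD[OF diff[OF kl], of 0 1] n by auto
  qed
  have "inj_on Q {1..m}"
    by (rule linorder_inj_onI) (use Q_neq in auto)
  then have "card (Q ` {1..m}) = m"
    by (simp add: card_image)
  moreover have "mols n (Q ` {1..m})"
    unfolding mols_def pairwise_def
  proof (intro conjI ballI impI)
    fix L assume "L \<in> Q ` {1..m}"
    then show "\<exists>V. latin_square n V L"
      using latin by blast
  next
    fix L M assume "L \<in> Q ` {1..m}" "M \<in> Q ` {1..m}" "L \<noteq> M"
    then obtain k l where kl: "k \<le> m" "l \<le> m" "L = Q k" "M = Q l" "k \<noteq> l"
      by (metis atLeastAtMost_iff imageE)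
    then show "orthogonal_squares n L M"
      using orth[of k l] orth[of l k] orthogonal_squares_commute
      by (cases k l rule: linorder_cases) auto
  qed
  ultimately show ?thesis
    using le_max_mols_iff[OF n(2)] by blast
qed

unbundle bit_operations_syntax

text \<open>Elements of \<open>\<int>\<^sub>2\<^sup>4\<close> are written as numbers below 16, with bitwise addition.\<close>

definition G48 :: "(nat \<times> nat) monoid" where
  "G48 = \<lparr>carrier = {..<16} \<times> {..<3},
          mult = (\<lambda>(a, b) (c, d). (a XOR c, (b + d) mod 3)), one = (0, 0)\<rparr>"

text \<open>An executable form of the left quotient: XOR is self-inverse, and \<open>2 * b\<close>
  is \<open>-b\<close> modulo 3.\<close>

definition diff48 :: "nat \<times> nat \<Rightarrow> nat \<times> nat \<Rightarrow> nat \<times> nat" where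
  "diff48 = (\<lambda>(a, b) (c, d). (a XOR c, (2 * b + d) mod 3))"

text \<open>\<open>slopes ! k\<close> lists the images under \<open>s\<^sub>k\<close> of the two unit vectors, and \<open>offsets ! k ! z\<close> is
  \<open>(a\<^sub>k(z), b\<^sub>k(z))\<close>.\<close>

definition slopes :: "(nat \<times> nat) list" where
  "slopes = [(14, 9), (7, 15), (6, 13), (15, 11), (5, 12), (12, 10),
     (0, 0), (1, 2), (13, 8), (4, 14), (3, 1)]"

definition offsets :: "(nat \<times> nat) list list" where
  "offsets =
   [[(2, 0), (5, 0), (8, 0), (11, 0), (9, 1), (0, 1), (0, 1), (14, 1), (4, 2), (11, 2), (10, 2), (6, 2)],
    [(1, 0), (4, 0), (10, 0), (6, 1), (7, 0), (7, 2), (5, 2), (8, 2), (13, 1), (0, 1), (0, 1), (9, 2)],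
    [(11, 0), (6, 0), (10, 1), (9, 2), (2, 2), (0, 0), (12, 1), (15, 2), (0, 0), (14, 1), (8, 2), (9, 1)],
    [(7, 0), (5, 1), (9, 0), (1, 2), (6, 2), (13, 1), (4, 2), (0, 0), (15, 2), (0, 0), (12, 1), (6, 1)],
    [(14, 0), (0, 1), (4, 2), (3, 0), (13, 1), (7, 2), (5, 0), (15, 2), (12, 0), (14, 2), (11, 1), (0, 1)],
    [(12, 0), (3, 1), (13, 2), (8, 1), (4, 2), (15, 0), (11, 0), (6, 1), (2, 2), (10, 1), (1, 0), (5, 2)],
    [(4, 0), (0, 1), (0, 2), (8, 2), (12, 0), (0, 2), (12, 1), (0, 1), (4, 1), (4, 0), (0, 2), (12, 0)],
    [(8, 0), (0, 2), (0, 1), (12, 0), (4, 2), (8, 0), (0, 2), (8, 1), (0, 1), (0, 2), (12, 1), (12, 0)],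
    [(13, 0), (8, 2), (0, 1), (14, 1), (3, 0), (13, 2), (7, 1), (12, 0), (15, 2), (11, 2), (10, 0), (0, 1)],
    [(12, 0), (14, 2), (3, 1), (8, 2), (4, 1), (5, 1), (2, 0), (1, 2), (9, 1), (15, 0), (7, 0), (10, 2)],
    [(12, 0), (8, 2), (4, 2), (4, 1), (8, 1), (8, 1), (0, 2), (0, 0), (0, 0), (4, 1), (0, 2), (0, 0)]]"

text \<open>The four-element list runs through the values of \<open>s\<^sub>k\<close> on
  \<open>\<int>\<^sub>2\<^sup>2\<close>. All rows use the same order, so position
  \<open>4 * z + u\<close> is the same column \<open>(z, u)\<close> throughout, with
  \<open>u\<close> numbered from 0 to 3.\<close>

definition rows48 :: "(nat \<times> nat) list list" where
  "rows48 = map2 (\<lambda>(s, t) os. concat (map (\<lambda>(a, b). map (\<lambda>u. (a XOR u, b)) [0, s, t, s XOR t]) os))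
     slopes offsets"

text \<open>Being below 16 means being fixed by truncation to 4 bits, which commutes with
  XOR.\<close>

lemma xor_less_16: "a XOR b < 16" if "a < 16" "b < 16" for a b :: nat
  using that by (simp flip: take_bit_nat_eq_self_iff[of 4, simplified])

lemma order_G48: "order G48 = 48"
  by (simp add: order_def G48_def)

lemma group_G48: "group G48"
proof (rule groupI)
  fix x assume "x \<in> carrier G48"
  then show "\<exists>y\<in>carrier G48. y \<otimes>\<^bsub>G48\<^esub> x = \<one>\<^bsub>G48\<^esub>"
    by (intro bexI[of _ "(fst x, (2 * snd x) mod 3)"]) (auto simp: G48_def, presburger)
qed (auto simp: G48_def xor_less_16 ac_simps mod_simps)

lemma inv_mult_G48:
  assumes "x \<in> carrier G48" "y \<in> carrier G48"
  shows "inv\<^bsub>G48\<^esub> x \<otimes>\<^bsub>G48\<^esub> y = diff48 x y"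
proof -
  interpret group G48 by (rule group_G48)
  obtain a b where x: "x = (a, b)" by (cases x)
  have "inv\<^bsub>G48\<^esub> x = (a, (2 * b) mod 3)"
    using assms(1) by (intro inv_equality) (auto simp: x G48_def, presburger)
  then show ?thesis
    by (auto simp: x G48_def diff48_def mod_simps split: prod.splits)
qed

lemma rows48_carrier:
  "length rows48 = 11 \<and> (\<forall>r\<in>set rows48. length r = 48 \<and> (\<forall>x\<in>set r. fst x < 16 \<and> snd x < 3))"
  by code_simp

text \<open>The difference matrix property, a finite check over the 55 pairs of rows.\<close>

lemma rows48_diff:
  "sorted_wrt (\<lambda>r s. distinct (map2 diff48 r s)) rows48"
  by code_simp

theorem theorem3: "max_mols 48 \<ge> 10"
proof -
  interpret group G48 by (rule group_G48)
  have len: "length (rows48 ! k) = 48" if "k \<le> 10" for k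
    using rows48_carrier that by auto
  have carrier: "rows48 ! k ! j \<in> carrier G48" if "k \<le> 10" "j < 48" for k j
  proof -
    have "rows48 ! k \<in> set rows48" "rows48 ! k ! j \<in> set (rows48 ! k)"
      using rows48_carrier len that by auto
    then show ?thesis
      using rows48_carrier by (auto simp: G48_def mem_Times_iff)
  qed
  show ?thesis
  proof (rule le_max_mols_if_difference_matrix[OF order_G48, where D = "\<lambda>k j. rows48 ! k ! j"])
    fix k l :: nat assume kl: "k < l" "l \<le> 10"
    have "distinct (map2 diff48 (rows48 ! k) (rows48 ! l))"
      using sorted_wrt_nth_less[OF rows48_diff] rows48_carrier kl by simp
    then have "inj_on (\<lambda>j. diff48 (rows48 ! k ! j) (rows48 ! l ! j)) {..<48}"
      using len kl by (auto simp: distinct_conv_nth inj_on_def)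
    then show "inj_on (\<lambda>j. inv\<^bsub>G48\<^esub> (rows48 ! k ! j) \<otimes>\<^bsub>G48\<^esub> rows48 ! l ! j) {..<48}"
      using carrier kl by (subst inj_on_cong[OF inv_mult_G48]) auto
  qed (use carrier in auto)
qed

end
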